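(* For every integer $n\ge 6$, the complement $\overline{W_n}$ of the wheel graph $W_n$ does not contain $K_{\lfloor 3(n-1)/4\rfloor+1}$ as a minor.
   Context: For $n\ge 4$, the wheel graph $W_n$ on $n$ vertices is the join $K_1+C_{n-1}$: a cycle on $n-1$ vertices together with one additional vertex adjacent to all vertices of the cycle. The complement $\overline{G}$ has the same vertex set as $G$, with two distinct vertices adjacent iff they are not adjacent in $G$. Minors are obtained by vertex deletions, edge deletions and edge contractions. *)

theory Defs
  imports "Graph_Theory.Graph_Theory"
begin

text \<open>
  Finite simple graphs are the \<^locale>\<open>pair_graph\<close>s of the Graph_Theory entry: finite, loopfree and
  symmetric, so that an undirected edge $uv$ is the pair of arcs \<open>(u, v)\<close> and \<open>(v, u)\<close>.
\<close>

definition cycle_graph :: "nat \<Rightarrow> nat pair_pre_digraph" where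
  "cycle_graph m = \<lparr> pverts = {..<m},
     parcs = {(i, j). i < m \<and> j < m \<and> (j = Suc i mod m \<or> i = Suc j mod m)} \<rparr>"

text \<open>The number \<open>n\<close> counts all vertices of the wheel; the hub is the vertex \<open>n - 1\<close>.\<close>

definition wheel_graph :: "nat \<Rightarrow> nat pair_pre_digraph" where
  "wheel_graph n = \<lparr> pverts = insert (n - 1) (pverts (cycle_graph (n - 1))),
     parcs = parcs (cycle_graph (n - 1))
       \<union> {n - 1} \<times> pverts (cycle_graph (n - 1))
       \<union> pverts (cycle_graph (n - 1)) \<times> {n - 1} \<rparr>"

definition complement_graph :: "'a pair_pre_digraph \<Rightarrow> 'a pair_pre_digraph" where
  "complement_graph G = \<lparr> pverts = pverts G,
     parcs = {(u, v). u \<in> pverts G \<and> v \<in> pverts G \<and> u \<noteq> v \<and> (u, v) \<notin> parcs G} \<rparr>"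

definition delete_vertex :: "'a pair_pre_digraph \<Rightarrow> 'a \<Rightarrow> 'a pair_pre_digraph" where
  "delete_vertex G v = \<lparr> pverts = pverts G - {v},
     parcs = {(x, y) \<in> parcs G. x \<noteq> v \<and> y \<noteq> v} \<rparr>"

definition delete_edge :: "'a pair_pre_digraph \<Rightarrow> 'a \<Rightarrow> 'a \<Rightarrow> 'a pair_pre_digraph" where
  "delete_edge G u v = \<lparr> pverts = pverts G, parcs = parcs G - {(u, v), (v, u)} \<rparr>"

text \<open>
  The vertex arising from the contraction of $uv$ is again called \<open>u\<close>. The loop that the contraction
  creates is dropped, and parallel edges are identified.
\<close>

definition contract_edge :: "'a pair_pre_digraph \<Rightarrow> 'a \<Rightarrow> 'a \<Rightarrow> 'a pair_pre_digraph" where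
  "contract_edge G u v = (let f = (\<lambda>x. if x = v then u else x) in
     \<lparr> pverts = f ` pverts G,
       parcs = {(f x, f y) | x y. (x, y) \<in> parcs G \<and> f x \<noteq> f y} \<rparr>)"

inductive minor_step :: "'a pair_pre_digraph \<Rightarrow> 'a pair_pre_digraph \<Rightarrow> bool" where
  delete_vertex: "v \<in> pverts G \<Longrightarrow> minor_step G (delete_vertex G v)"
| delete_edge: "(u, v) \<in> parcs G \<Longrightarrow> minor_step G (delete_edge G u v)"
| contract_edge: "(u, v) \<in> parcs G \<Longrightarrow> minor_step G (contract_edge G u v)"

definition has_minor :: "'a pair_pre_digraph \<Rightarrow> 'b pair_pre_digraph \<Rightarrow> bool" where
  "has_minor G H \<longleftrightarrow> (\<exists>G'. minor_step\<^sup>*\<^sup>* G G' \<and> digraph_iso (with_proj G') (with_proj H))"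

lemma digraph_iso_with_proj_iff:
  assumes "pair_wf_digraph G"
  shows "digraph_iso (with_proj G) (with_proj H) \<longleftrightarrow>
    (\<exists>f. inj_on f (pverts G) \<and> pverts H = f ` pverts G \<and>
      parcs H = (\<lambda>(x, y). (f x, f y)) ` parcs G)" (is "_ \<longleftrightarrow> ?R")
proof -
  interpret pair_wf_digraph G by fact
  show ?thesis
  proof
    assume "digraph_iso (with_proj G) (with_proj H)"
    then obtain h where h: "pre_digraph.digraph_isomorphism (with_proj G) h"
        "with_proj H = app_iso h (with_proj G)"
      by (auto simp: digraph_iso_def)
    have t: "iso_tail h = fst" "iso_head h = snd" "pverts H = iso_verts h ` pverts G"
      "parcs H = iso_arcs h ` parcs G"
      using h(2) by (simp_all add: with_proj_def app_iso_def)
    have "iso_arcs h a = (case a of (x, y) \<Rightarrow> (iso_verts h x, iso_verts h y))"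
      if "a \<in> parcs G" for a
      using h(1) that t
      by (auto simp: pre_digraph.digraph_isomorphism_def with_proj_def prod_eq_iff split: prod.splits)
    then have "iso_arcs h ` parcs G = (\<lambda>(x, y). (iso_verts h x, iso_verts h y)) ` parcs G"
      by (rule image_cong[OF refl])
    with h(1) t show ?R
      by (auto simp: pre_digraph.digraph_isomorphism_def with_proj_def intro!: exI[of _ "iso_verts h"])
  next
    assume ?R
    then obtain f where f: "inj_on f (pverts G)" "pverts H = f ` pverts G"
        "parcs H = (\<lambda>(x, y). (f x, f y)) ` parcs G"
      by blast
    let ?h = "\<lparr> iso_verts = f, iso_arcs = (\<lambda>(x, y). (f x, f y)), iso_head = snd, iso_tail = fst \<rparr>"
    have "inj_on (\<lambda>(x, y). (f x, f y)) (parcs G)"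
      using f(1) by (auto simp: inj_on_def dest: in_arcsD1 in_arcsD2)
    then have "pre_digraph.digraph_isomorphism (with_proj G) ?h"
      using f(1) wf_digraph
      by (auto simp: pre_digraph.digraph_isomorphism_def with_proj_def)
    moreover have "with_proj H = app_iso ?h (with_proj G)"
      using f by (simp add: with_proj_def app_iso_def)
    ultimately show "digraph_iso (with_proj G) (with_proj H)"
      unfolding digraph_iso_def by blast
  qed
qed

lemma pair_graph_wheel_graph:
  assumes "n \<ge> 4"
  shows "pair_graph (wheel_graph n)"
proof -
  have "Suc i mod (n - 1) \<noteq> i" if "i < n - 1" for i
    using that assms by (cases "Suc i = n - 1") auto
  then show ?thesis
    by unfold_locales
      (force simp: wheel_graph_def cycle_graph_def symmetric_def intro!: symI
        intro: finite_subset[of _ "{..<n - 1} \<times> {..<n - 1}"])+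
qed

lemma pair_graph_complement_graph:
  assumes "pair_graph G"
  shows "pair_graph (complement_graph G)"
proof -
  interpret pair_graph G by fact
  show ?thesis
    by unfold_locales
      (auto simp: complement_graph_def symmetric_def intro!: symI dest: arcs_symmetric
        intro: finite_subset[of _ "pverts G \<times> pverts G"])
qed

lemma pair_graph_minor_step:
  assumes "minor_step G H" "pair_graph G"
  shows "pair_graph H"
proof -
  interpret pair_graph G by fact
  from assms(1) show ?thesis
  proof cases
    case (delete_vertex v)
    then show ?thesis
      by unfold_locales
        (auto simp: delete_vertex_def symmetric_def intro!: symI dest: arcs_symmetric in_arcsD1
          in_arcsD2 no_loops intro: finite_subset[OF _ pair_finite_arcs])
  next
    case (delete_edge u v)
    then show ?thesis
      by unfold_locales
        (auto simp: delete_edge_def symmetric_def intro!: symI dest: arcs_symmetric in_arcsD1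
          in_arcsD2 no_loops)
  next
    case (contract_edge u v)
    have "parcs H \<subseteq> pverts H \<times> pverts H"
      unfolding contract_edge(1)
      using in_arcsD1[OF contract_edge(2)] no_loops[OF contract_edge(2)]
      by (auto simp: contract_edge_def Let_def intro!: image_eqI dest: in_arcsD1 in_arcsD2)
    moreover have "finite (pverts H)"
      unfolding contract_edge(1) by (simp add: contract_edge_def Let_def)
    moreover have "sym (parcs H)"
      unfolding contract_edge(1)
      by (rule symI) (simp add: contract_edge_def Let_def, metis arcs_symmetric)
    moreover have "x \<noteq> y" if "(x, y) \<in> parcs H" for x y
      using that unfolding contract_edge(1) by (auto simp: contract_edge_def Let_def)
    ultimately show ?thesis
      by unfold_locales (auto simp: symmetric_def intro: finite_subset)
  qed
qed

end

theory Submission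
  imports Defs
begin

text \<open>
  A minor of \<open>G\<close> yields disjoint nonempty branch sets in \<open>G\<close> with an arc of \<open>G\<close> for every arc of the
  minor; here they are the fibres of a map \<open>\<phi>\<close>, and their connectedness is not needed. In the
  complement of the wheel the hub is isolated, so it can be dropped from the branch sets of a complete
  minor, which leaves disjoint nonempty sets of vertices of the rim $C_m$ with $m = n - 1$. The vertices
  that are singleton branch sets are pairwise adjacent in the complement, hence independent in $C_m$,
  so there are at most $m / 2$ of them. The other branch sets have at least two vertices, and
  $t$ branch sets thus satisfy $2 t \le m + \lfloor m / 2 \rfloor$.
\<close>

text \<open>In effect a partial map with domain \<open>S\<close>: deleting a vertex shrinks
  \<open>S\<close>, and contracting an edge composes \<open>\<phi>\<close> with the merging
  map.\<close>

definition branch_map ::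
    "'a pair_pre_digraph \<Rightarrow> 'b pair_pre_digraph \<Rightarrow> 'a set \<Rightarrow> ('a \<Rightarrow> 'b) \<Rightarrow> bool" where
  "branch_map G H S \<phi> \<longleftrightarrow> \<phi> ` S = pverts H \<and>
     (\<forall>x y. (x, y) \<in> parcs H \<longrightarrow> (\<exists>u\<in>S. \<exists>v\<in>S. (u, v) \<in> parcs G \<and> \<phi> u = x \<and> \<phi> v = y))"

text \<open>Serves both for contractions and for the final isomorphism. For the arcs an inclusion is
  assumed because contraction drops the loop that it creates.\<close>

lemma branch_map_comp:
  assumes "branch_map G H S \<phi>" "pverts H' = f ` pverts H"
    and "parcs H' \<subseteq> (\<lambda>(x, y). (f x, f y)) ` parcs H"
  shows "branch_map G H' S (f \<circ> \<phi>)"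
  unfolding branch_map_def
proof (intro conjI allI impI)
  show "(f \<circ> \<phi>) ` S = pverts H'"
    using assms(1,2) unfolding branch_map_def by (metis image_comp)
next
  fix x y assume "(x, y) \<in> parcs H'"
  then obtain x' y' where "(x', y') \<in> parcs H" "x = f x'" "y = f y'"
    using assms(3) by auto
  then show "\<exists>u\<in>S. \<exists>v\<in>S. (u, v) \<in> parcs G \<and> (f \<circ> \<phi>) u = x \<and> (f \<circ> \<phi>) v = y"
    using assms(1) unfolding branch_map_def comp_def by metis
qed

lemma branch_map_minor_step:
  assumes "minor_step G' G''" "branch_map G G' S \<phi>"
  shows "\<exists>S \<phi>. branch_map G G'' S \<phi>"
  using assms(1)
proof cases
  case (delete_vertex w)
  have "branch_map G G'' {u \<in> S. \<phi> u \<noteq> w} \<phi>"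
    unfolding branch_map_def
  proof (intro conjI allI impI)
    show "\<phi> ` {u \<in> S. \<phi> u \<noteq> w} = pverts G''"
      using assms(2) unfolding delete_vertex(1) branch_map_def delete_vertex_def by auto
  next
    fix x y assume "(x, y) \<in> parcs G''"
    then have "(x, y) \<in> parcs G'" "x \<noteq> w" "y \<noteq> w"
      unfolding delete_vertex(1) delete_vertex_def by auto
    then show "\<exists>u\<in>{u \<in> S. \<phi> u \<noteq> w}. \<exists>v\<in>{u \<in> S. \<phi> u \<noteq> w}. (u, v) \<in> parcs G \<and> \<phi> u = x \<and> \<phi> v = y"
      using assms(2) unfolding branch_map_def by blast
  qed
  then show ?thesis by blast
next
  case (delete_edge u v)
  have "branch_map G G'' S \<phi>"
    using assms(2) unfolding delete_edge(1) branch_map_def delete_edge_def by simp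
  then show ?thesis by blast
next
  case (contract_edge u v)
  define f where "f = (\<lambda>x. if x = v then u else x)"
  have "branch_map G G'' S (f \<circ> \<phi>)"
  proof (rule branch_map_comp[OF assms(2)])
    show "pverts G'' = f ` pverts G'"
      unfolding contract_edge(1) contract_edge_def f_def by simp
    have "parcs G'' = {(f x, f y) | x y. (x, y) \<in> parcs G' \<and> f x \<noteq> f y}"
      unfolding contract_edge(1) contract_edge_def f_def by simp
    then show "parcs G'' \<subseteq> (\<lambda>(x, y). (f x, f y)) ` parcs G'"
      by force
  qed
  then show ?thesis by blast
qed

lemma has_minor_branch_map:
  assumes "pair_graph G" "has_minor G H"
  shows "\<exists>S \<phi>. branch_map G H S \<phi>"
proof -
  obtain G' where G': "minor_step\<^sup>*\<^sup>* G G'" "digraph_iso (with_proj G') (with_proj H)"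
    using assms(2) unfolding has_minor_def by blast
  \<comment> \<open>The induction carries \<open>pair_graph G'\<close> along, since unfolding the
    isomorphism below requires \<open>G'\<close> to be well-formed.\<close>
  from G'(1) have "pair_graph G' \<and> (\<exists>S \<phi>. branch_map G G' S \<phi>)"
  proof induction
    case base
    interpret pair_graph G by fact
    have "branch_map G G (pverts G) id"
      unfolding branch_map_def by (auto dest: in_arcsD1 in_arcsD2)
    with assms(1) show ?case by blast
  next
    case (step G' G'')
    then show ?case
      using pair_graph_minor_step branch_map_minor_step by blast
  qed
  then obtain S \<phi> where "pair_graph G'" and \<phi>: "branch_map G G' S \<phi>"
    by blast
  interpret pair_graph G' by fact
  obtain f where "pverts H = f ` pverts G'" "parcs H = (\<lambda>(x, y). (f x, f y)) ` parcs G'"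
    using digraph_iso_with_proj_iff[OF pair_wf_digraph_axioms, THEN iffD1, OF G'(2)]
    by (elim exE conjE)
  then have "branch_map G H S (f \<circ> \<phi>)"
    by (intro branch_map_comp[OF \<phi>]) simp_all
  then show ?thesis by blast
qed

text \<open>Pick one representative in each fibre of \<open>f\<close> on \<open>T\<close>. A value
  whose fibre is not a singleton is also attained at one of the \<open>card T - card R\<close>
  non-representatives.\<close>

lemma two_card_image_le:
  assumes "finite T"
  shows "2 * card (f ` T) \<le> card T + card {u \<in> T. \<forall>v\<in>T. f v = f u \<longrightarrow> v = u}"
    (is "_ \<le> _ + card ?I")
proof -
  define R where "R = inv_into T f ` f ` T"
  have R: "R \<subseteq> T" "card R = card (f ` T)"
    unfolding R_def by (auto intro: inv_into_into card_image inj_on_inv_into)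
  have "f ` T \<subseteq> f ` ?I \<union> f ` (T - R)"
  proof
    fix y assume "y \<in> f ` T"
    define r where "r = inv_into T f y"
    have r: "r \<in> T" "f r = y"
      using \<open>y \<in> f ` T\<close> by (auto simp: r_def inv_into_into f_inv_into_f)
    show "y \<in> f ` ?I \<union> f ` (T - R)"
    proof (cases "r \<in> ?I")
      case False
      then obtain v where v: "v \<in> T" "f v = y" "v \<noteq> r"
        using r by auto
      \<comment> \<open>The only element of \<open>R\<close> over \<open>y\<close> is
        \<open>r\<close>.\<close>
      then have "v \<notin> R"
        unfolding R_def r_def by (auto simp: f_inv_into_f)
      with v show ?thesis by blast
    qed (use r in blast)
  qed
  then have "card (f ` T) \<le> card (f ` ?I \<union> f ` (T - R))"
    using assms by (intro card_mono) auto
  also have "\<dots> \<le> card ?I + card (T - R)"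
    using assms by (intro order.trans[OF card_Un_le] add_mono card_image_le) auto
  also have "card (T - R) = card T - card R"
    using assms R(1) by (simp add: card_Diff_subset finite_subset)
  finally show ?thesis
    using R(2) card_mono[OF assms R(1)] by simp
qed

lemma inj_on_Suc_mod: "inj_on (\<lambda>i. Suc i mod m) {..<m}"
  by (auto simp: inj_on_def mod_Suc split: if_splits)

text \<open>The set and its image under the cyclic shift are disjoint and of equal size.\<close>

lemma independent_cycle_card:
  assumes "I \<subseteq> {..<m}" "\<And>i. i \<in> I \<Longrightarrow> Suc i mod m \<notin> I"
  shows "2 * card I \<le> m"
proof -
  let ?s = "\<lambda>i. Suc i mod m"
  have "card (I \<union> ?s ` I) = card I + card (?s ` I)"
    using assms by (intro card_Un_disjoint) (auto intro: finite_subset)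
  moreover have "card (?s ` I) = card I"
    using assms(1) inj_on_Suc_mod by (intro card_image) (rule inj_on_subset)
  moreover have "card (I \<union> ?s ` I) \<le> card {..<m}"
    using assms(1) by (intro card_mono) force+
  ultimately show ?thesis by simp
qed

text \<open>The two bounds express that the hub is isolated in the complement.\<close>

lemma arcs_complement_wheel:
  assumes "(u, v) \<in> parcs (complement_graph (wheel_graph n))"
  shows "u < n - 1" "v < n - 1" "v \<noteq> Suc u mod (n - 1)"
  using assms by (auto simp: complement_graph_def wheel_graph_def cycle_graph_def)

theorem theorem5:
  fixes n :: nat and K :: "'a pair_pre_digraph"
  assumes "n \<ge> 6"
    and "K\<^bsub>(3 * (n - 1)) div 4 + 1\<^esub> (with_proj K)"
  shows "\<not> has_minor (complement_graph (wheel_graph n)) K"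
proof
  let ?G = "complement_graph (wheel_graph n)"
  define m where "m = n - 1"
  have K: "card (pverts K) = 3 * m div 4 + 1"
    "parcs K = {(x, y). x \<in> pverts K \<and> y \<in> pverts K \<and> x \<noteq> y}"
    using assms(2) by (auto simp: complete_digraph_pair_def m_def)
  note arcs = arcs_complement_wheel[of _ _ n, folded m_def]
  assume "has_minor ?G K"
  then obtain S \<phi> where "branch_map ?G K S \<phi>"
    using has_minor_branch_map pair_graph_complement_graph pair_graph_wheel_graph[of n] assms(1)
    by fastforce
  then have S: "\<phi> ` S = pverts K"
    and adj: "\<And>x y. x \<in> pverts K \<Longrightarrow> y \<in> pverts K \<Longrightarrow> x \<noteq> y \<Longrightarrow>
      \<exists>u\<in>S. \<exists>v\<in>S. (u, v) \<in> parcs ?G \<and> \<phi> u = x \<and> \<phi> v = y"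
    unfolding branch_map_def K(2) by auto
  define T where "T = {u \<in> S. u < m}"
  define I where "I = {u \<in> T. \<forall>v\<in>T. \<phi> v = \<phi> u \<longrightarrow> v = u}"
  have m: "m \<ge> 5"
    using assms(1) by (simp add: m_def)
  \<comment> \<open>Dropping the hub empties no branch set: \<open>K\<close> has a second vertex,
    and the arc realising the adjacency to it has both ends on the rim.\<close>
  have "x \<in> \<phi> ` T" if "x \<in> pverts K" for x
  proof -
    have "pverts K \<noteq> {x}"
      using K(1) m by auto
    then obtain y where "y \<in> pverts K" "x \<noteq> y"
      using \<open>x \<in> pverts K\<close> by blast
    then show ?thesis
      using adj[OF that] arcs(1) unfolding T_def by blast
  qed
  then have T: "\<phi> ` T = pverts K"
    using S unfolding T_def by blast
  have "T \<subseteq> {..<m}"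
    unfolding T_def by auto
  have "2 * card I \<le> m"
  proof (rule independent_cycle_card)
    show "I \<subseteq> {..<m}"
      using \<open>T \<subseteq> {..<m}\<close> unfolding I_def by blast
  next
    fix i assume i: "i \<in> I"
    show "Suc i mod m \<notin> I"
    proof
      let ?j = "Suc i mod m"
      assume j: "?j \<in> I"
      have ij: "i \<in> T" "?j \<in> T"
        and uniq: "\<And>v. v \<in> T \<Longrightarrow> \<phi> v = \<phi> i \<Longrightarrow> v = i" "\<And>v. v \<in> T \<Longrightarrow> \<phi> v = \<phi> ?j \<Longrightarrow> v = ?j"
        using i j by (simp_all add: I_def)
      have "i < m"
        using ij(1) by (simp add: T_def)
      then have "?j \<noteq> i"
        using m by (simp add: mod_Suc)
      then have "\<phi> i \<noteq> \<phi> ?j"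
        using uniq(1)[OF ij(2)] by auto
      moreover have "\<phi> i \<in> pverts K" "\<phi> ?j \<in> pverts K"
        using ij T by blast+
      ultimately obtain u v
        where uv: "u \<in> S" "v \<in> S" "(u, v) \<in> parcs ?G" "\<phi> u = \<phi> i" "\<phi> v = \<phi> ?j"
        using adj by metis
      then have "u \<in> T" "v \<in> T"
        using arcs(1,2)[OF uv(3)] by (simp_all add: T_def)
      \<comment> \<open>Both fibres on \<open>T\<close> are singletons, so the arc between them
        would join \<open>i\<close> to its successor on the rim.\<close>
      then have "u = i" "v = ?j"
        using uniq uv(4,5) by simp_all
      with arcs(3)[OF uv(3)] show False by simp
    qed
  qed
  moreover have "card T \<le> m"
    using card_mono[OF _ \<open>T \<subseteq> {..<m}\<close>] by simp
  moreover have "2 * card (pverts K) \<le> card T + card I"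
    using two_card_image_le[of T \<phi>] \<open>T \<subseteq> {..<m}\<close> T unfolding I_def by (auto intro: finite_subset)
  \<comment> \<open>The bounds give \<open>4 * card (pverts K) \<le> 3 * m\<close>, but
    \<open>4 * (3 * m div 4 + 1)\<close> exceeds \<open>3 * m\<close>.\<close>
  ultimately show False
    using K(1) by linarith
qed

end
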